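(* For every integer $k\geq 1$ there is a constant $C>0$ (which may depend on $k$) such that for all integers $N>k$, \[ r(1+2^k,N)\ \ge\ N\exp\!\big(-C (\log N )^{1/(k+1)}\big). \]
   Context: For integers $\ell\ge 1$ and $N\ge 1$, $r(\ell,N)$ denotes the maximal cardinality of a subset $A\subseteq\{1,2,\ldots,N\}$ which does not contain an arithmetic progression of length $\ell$, i.e. $A$ contains no set of the form $\{x+jy : 0\le j<\ell\}$ with $x,y$ integers and $y\neq 0$. *)

theory Defs
  imports Complex_Main
begin

definition contains_ap :: "nat \<Rightarrow> int set \<Rightarrow> bool" where
  "contains_ap l A \<longleftrightarrow> (\<exists>x y :: int. y \<noteq> 0 \<and> {x + int j * y | j :: nat. j < l} \<subseteq> A)"

(* For l = 0 no set avoids progressions, so the maximum below is over the empty set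
   and r 0 N is meaningless; for l \<ge> 1 the empty set is always admissible. *)
definition r :: "nat \<Rightarrow> nat \<Rightarrow> nat" where
  "r l N = Max {card A | A. A \<subseteq> {1..int N} \<and> \<not> contains_ap l A}"

end

(* By induction on k one builds, for every degree bound D, a dense set containing no
   p(0), ..., p(2^k D) for a nonconstant real polynomial p of degree at most D; the theorem is
   the case D = 1.  In the induction step, take the set B given for degree 2D and collect the
   numbers whose base b digits x_1, ..., x_d are below b / 2^(D+1) and satisfy
   x_1^2 + ... + x_d^2 + t : B, for a shift t found by averaging.  The digits are so small that
   the (D+1)-st differences of a polynomial progression vanish digit by digit, so every digit is
   itself a polynomial of degree at most D in the index.  Their sum of squares has degree at most
   2D and takes values in B - t, hence is constant; so the digits are constant.
   With d about (log N)^(1/(k+1)) digits, B lives in an interval of length about d N^(2/d), whose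
   logarithm is O((log N)^(k/(k+1))), and the losses multiply to exp(-O(d)). *)
theory Submission
  imports Defs "HOL-Computational_Algebra.Fundamental_Theorem_Algebra" "HOL-Library.FuncSet"
begin

section \<open>Finite differences and interpolation\<close>

text \<open>The \<open>m\<close>-th forward difference. Differencing first and recursing on the
  result suits inductions on \<open>m\<close> that generalise over the sequence.\<close>

primrec fdiff :: "nat \<Rightarrow> (nat \<Rightarrow> 'a::ab_group_add) \<Rightarrow> nat \<Rightarrow> 'a" where
  "fdiff 0 a = a"
| "fdiff (Suc m) a = fdiff m (\<lambda>j. a (Suc j) - a j)"

lemma fdiff_cong:
  assumes "\<And>i. j \<le> i \<Longrightarrow> i \<le> j + m \<Longrightarrow> a i = b i"
  shows "fdiff m a j = fdiff m b j"
  using assms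
proof (induction m arbitrary: a b)
  case (Suc m)
  show ?case
    unfolding fdiff.simps by (rule Suc.IH) (simp add: Suc.prems)
qed simp

lemma fdiff_diff: "fdiff m (\<lambda>j. a j - b j) j = fdiff m a j - fdiff m b j"
proof (induction m arbitrary: a b)
  case (Suc m)
  show ?case
    by (simp add: Suc.IH [symmetric] algebra_simps)
qed simp

lemma fdiff_zero: "fdiff m (\<lambda>j. 0) j = 0"
  by (induction m) auto

lemma fdiff_add: "fdiff m (\<lambda>j. a j + b j) j = fdiff m a j + fdiff m b j"
proof (induction m arbitrary: a b)
  case (Suc m)
  show ?case
    by (simp add: Suc.IH [symmetric] algebra_simps)
qed simp

lemma fdiff_sum: "fdiff m (\<lambda>j. \<Sum>i\<in>I. a i j) j = (\<Sum>i\<in>I. fdiff m (a i) j)"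
  by (induction I rule: infinite_finite_induct) (simp_all add: fdiff_zero fdiff_add)

lemma fdiff_mult_right:
  fixes c :: "'a::ring"
  shows "fdiff m (\<lambda>j. a j * c) j = fdiff m a j * c"
proof (induction m arbitrary: a)
  case (Suc m)
  show ?case
    by (simp add: Suc.IH [symmetric] algebra_simps)
qed simp

lemma of_int_fdiff: "of_int (fdiff m a j) = fdiff m (\<lambda>j. of_int (a j) :: 'a::ring_1) j"
proof (induction m arbitrary: a)
  case (Suc m)
  show ?case
    by (simp add: Suc.IH)
qed simp

lemma abs_fdiff_le:
  fixes a :: "nat \<Rightarrow> 'a::linordered_idom"
  assumes "\<And>i. j \<le> i \<Longrightarrow> i \<le> j + m \<Longrightarrow> \<bar>a i\<bar> \<le> c"
  shows "\<bar>fdiff m a j\<bar> \<le> 2 ^ m * c"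
  using assms
proof (induction m arbitrary: a c)
  case (Suc m)
  have "\<bar>fdiff m (\<lambda>j. a (Suc j) - a j) j\<bar> \<le> 2 ^ m * (2 * c)"
  proof (rule Suc.IH)
    fix i assume "j \<le> i" "i \<le> j + m"
    then have "\<bar>a (Suc i)\<bar> \<le> c" "\<bar>a i\<bar> \<le> c"
      using Suc.prems by simp_all
    then show "\<bar>a (Suc i) - a i\<bar> \<le> 2 * c"
      by linarith
  qed
  then show ?case
    by (simp add: mult_ac)
qed simp

text \<open>Substituting x + 1 for x keeps the leading coefficient, so the difference polynomial
  \<open>q\<close> is zero or has smaller degree than \<open>p\<close>.\<close>

lemma fdiff_poly_eq_0:
  fixes p :: "'a::idom poly"
  assumes "degree p < m"
  shows "fdiff m (\<lambda>j. poly p (of_nat j)) i = 0"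
  using assms
proof (induction m arbitrary: p)
  case (Suc m)
  define q where "q = pcompose p [:1, 1:] - p"
  have q: "poly p (of_nat (Suc j)) - poly p (of_nat j) = poly q (of_nat j)" for j
    by (simp add: q_def poly_pcompose)
  show ?case
  proof (cases "q = 0")
    case True
    then show ?thesis
      using q by (simp add: fdiff_zero)
  next
    case False
    have "coeff (pcompose p [:1, 1:]) (degree p) = lead_coeff p"
      using lead_coeff_comp [of "[:1, 1:]" p] by (simp add: degree_pcompose)
    then have "coeff q (degree p) = 0"
      by (simp add: q_def)
    moreover have "degree q \<le> degree p"
      unfolding q_def by (rule degree_diff_le) (simp_all add: degree_pcompose)
    ultimately have "degree q < degree p"
      using False by (metis leading_coeff_0_iff le_neq_implies_less)
    then have "degree q < m"
      using Suc.prems by simp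
    then show ?thesis
      using q Suc.IH [of q] by simp
  qed
qed simp

text \<open>By induction on \<open>m\<close>, the difference sequence vanishes on the window up to
  \<open>n - 1\<close>; hence \<open>a\<close> is constant there and equals its initial value
  0.\<close>

lemma fdiff_eq_0_imp_eq_0:
  assumes "\<And>j. j + m \<le> n \<Longrightarrow> fdiff m a j = 0"
    and "\<And>j. j < m \<Longrightarrow> a j = 0" and "j \<le> n"
  shows "a j = 0"
  using assms
proof (induction m arbitrary: a n j)
  case (Suc m)
  have step: "a (Suc i) = a i" if "Suc i \<le> n" for i
  proof -
    have "a (Suc i) - a i = 0"
    proof (rule Suc.IH [of "n - 1" "\<lambda>j. a (Suc j) - a j"])
      show "fdiff m (\<lambda>j. a (Suc j) - a j) l = 0" if "l + m \<le> n - 1" for l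
        using Suc.prems(1) [of l] that \<open>Suc i \<le> n\<close> by simp
    qed (use Suc.prems(2) that in auto)
    then show ?thesis
      by simp
  qed
  from \<open>j \<le> n\<close> show ?case
  proof (induction j)
    case 0
    then show ?case
      using Suc.prems(2) by simp
  next
    case (Suc i)
    then show ?case
      using step by simp
  qed
qed simp

text \<open>Newton interpolation: adding a multiple of \<open>w\<close>, which vanishes at 0, ...,
  D, corrects the value at D + 1 and leaves the earlier ones alone. The division explains why
  polynomials over a field appear although the data will be integers.\<close>

lemma ex_interpolating_poly:
  fixes v :: "nat \<Rightarrow> 'a::field_char_0"
  shows "\<exists>p. degree p \<le> D \<and> (\<forall>j\<le>D. poly p (of_nat j) = v j)"
proof (induction D)
  case 0
  show ?case
    by (rule exI [of _ "[:v 0:]"]) simp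
next
  case (Suc D)
  then obtain p where p: "degree p \<le> D" "\<And>j. j \<le> D \<Longrightarrow> poly p (of_nat j) = v j"
    by blast
  define w where "w = (\<Prod>i\<le>D. [:- of_nat i, 1 :: 'a:])"
  have w: "poly w (of_nat j) = (\<Prod>i\<le>D. of_nat j - of_nat i)" for j
    by (simp add: w_def poly_prod)
  have wSuc: "poly w (of_nat (Suc D)) \<noteq> 0"
    unfolding w by (auto simp del: of_nat_Suc)
  have deg_w: "degree w \<le> Suc D"
    unfolding w_def by (rule order.trans [OF degree_prod_sum_le]) simp_all
  define c where "c = (v (Suc D) - poly p (of_nat (Suc D))) / poly w (of_nat (Suc D))"
  show ?case
  proof (intro exI [of _ "p + smult c w"] conjI allI impI)
    show "degree (p + smult c w) \<le> Suc D"
      using p(1) deg_w by (intro degree_add_le) (auto intro: order.trans [OF degree_smult_le])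
    fix j assume "j \<le> Suc D"
    then consider "j \<le> D" | "j = Suc D"
      by linarith
    then show "poly (p + smult c w) (of_nat j) = v j"
    proof cases
      case 1
      then have "poly w (of_nat j) = 0"
        unfolding w by (intro prod_zero) auto
      then show ?thesis
        using p(2) 1 by simp
    next
      case 2
      then show ?thesis
        using wSuc by (simp add: c_def del: of_nat_Suc)
    qed
  qed
qed

text \<open>A converse to \<open>fdiff_poly_eq_0\<close>: subtract the interpolant of the first D +
  1 values; the remainder has vanishing differences and vanishing initial values.\<close>

lemma ex_poly_if_fdiff_eq_0:
  fixes u :: "nat \<Rightarrow> 'a::field_char_0"
  assumes "\<And>j. j + Suc D \<le> n \<Longrightarrow> fdiff (Suc D) u j = 0"
  shows "\<exists>p. degree p \<le> D \<and> (\<forall>j\<le>n. poly p (of_nat j) = u j)"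
proof -
  obtain p where p: "degree p \<le> D" "\<And>j. j \<le> D \<Longrightarrow> poly p (of_nat j) = u j"
    using ex_interpolating_poly [of D u] by blast
  have "u j - poly p (of_nat j) = 0" if "j \<le> n" for j
  proof (rule fdiff_eq_0_imp_eq_0 [of "Suc D" n "\<lambda>j. u j - poly p (of_nat j)"])
    fix i assume "i + Suc D \<le> n"
    then show "fdiff (Suc D) (\<lambda>j. u j - poly p (of_nat j)) i = 0"
      using assms [of i] fdiff_poly_eq_0 [of p "Suc D" i] p(1)
      by (subst fdiff_diff) (simp del: fdiff.simps)
  qed (use p that in auto)
  then show ?thesis
    using p(1) by auto
qed

section \<open>Signed base b digits\<close>

text \<open>Reduction modulo \<open>b\<close> kills the lowest digit, and the rest follows by
  induction. Negative digits are allowed because the lemma is applied to differences of digit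
  vectors.\<close>

lemma digits_eq_0:
  fixes e :: "nat \<Rightarrow> int"
  assumes "(\<Sum>i<d. e i * b ^ i) = 0" and "\<And>i. i < d \<Longrightarrow> \<bar>e i\<bar> < b" and "i < d"
  shows "e i = 0"
  using assms
proof (induction d arbitrary: e i)
  case (Suc d)
  have split: "(\<Sum>i<Suc d. e i * b ^ i) = e 0 + b * (\<Sum>i<d. e (Suc i) * b ^ i)"
    by (simp add: sum.lessThan_Suc_shift sum_distrib_left mult_ac del: sum.lessThan_Suc)
  then have "b dvd e 0"
    using Suc.prems(1) by (metis dvd_triv_left dvd_add_left_iff dvd_0_right)
  moreover have "\<bar>e 0\<bar> < b"
    using Suc.prems(2) by simp
  ultimately have e0: "e 0 = 0"
    using dvd_imp_le_int [of "e 0" b] by auto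
  have "b > 0"
    using \<open>\<bar>e 0\<bar> < b\<close> by linarith
  then have "(\<Sum>i<d. e (Suc i) * b ^ i) = 0"
    using split Suc.prems(1) e0 by simp
  then have "e (Suc i) = 0" if "i < d" for i
    using Suc.IH [of "\<lambda>i. e (Suc i)" i] Suc.prems(2) that by simp
  then show ?case
    using e0 Suc.prems(3) by (cases i) auto
qed simp

lemma digits_sum_less:
  fixes e :: "nat \<Rightarrow> int"
  assumes "\<And>i. i < d \<Longrightarrow> e i < b" and "b \<ge> 0"
  shows "(\<Sum>i<d. e i * b ^ i) < b ^ d"
  using assms(1)
proof (induction d)
  case (Suc d)
  have "e d * b ^ d \<le> (b - 1) * b ^ d"
    using Suc.prems [of d] assms(2) by (intro mult_right_mono) auto
  then show ?case
    using Suc by (fastforce simp: algebra_simps)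
qed simp

section \<open>Criteria for a polynomial to be constant\<close>

lemma degree_eq_0_if_constant_values:
  fixes p :: "'a::{idom,ring_char_0} poly"
  assumes "degree p \<le> n" and "\<And>j. j \<le> n \<Longrightarrow> poly p (of_nat j) = c"
  shows "degree p = 0"
proof -
  have "p = [:c:]"
    by (rule poly_eqI_degree [of "of_nat ` {..n}"])
      (use assms in \<open>auto simp: card_image inj_on_def\<close>)
  then show ?thesis
    by simp
qed

text \<open>Real squares cannot cancel, so each one is bounded by \<open>c - t\<close>, whereas a
  nonconstant polynomial is unbounded.\<close>

lemma degree_eq_0_if_sum_squares_constant:
  fixes p :: "'i \<Rightarrow> real poly"
  assumes "finite I" and "degree ((\<Sum>i\<in>I. (p i)\<^sup>2) + [:t:]) = 0" and "i \<in> I"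
  shows "degree (p i) = 0"
proof (rule ccontr)
  assume ne: "degree (p i) \<noteq> 0"
  obtain c where "(\<Sum>i\<in>I. (p i)\<^sup>2) + [:t:] = [:c:]"
    using assms(2) by (rule degree_eq_zeroE)
  then have c: "(\<Sum>i\<in>I. (poly (p i) x)\<^sup>2) + t = c" for x
    by (auto simp: poly_sum dest!: arg_cong [of _ _ "\<lambda>q. poly q x"])
  have le: "(poly (p i) x)\<^sup>2 \<le> c - t" for x
    using member_le_sum [of i I "\<lambda>i. (poly (p i) x)\<^sup>2"] assms c [of x] by auto
  obtain a q where pq: "p i = pCons a q"
    by (cases "p i")
  with ne have "q \<noteq> 0"
    by auto
  \<comment> \<open>With u = c - t, the threshold 1 + u avoids a square root: (1 + u)^2 exceeds u
    for every u \<ge> 0.\<close>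
  then obtain z where z: "1 + (c - t) \<le> norm (poly (pCons a q) z)"
    using poly_infinity [of q "1 + (c - t)" a] by (metis abs_ge_self real_norm_def)
  have "0 \<le> c - t"
    using le [of z] zero_le_power2 order_trans by blast
  then have "(1 + (c - t))\<^sup>2 \<le> (poly (p i) z)\<^sup>2"
    using z pq by (metis abs_le_square_iff abs_of_nonneg add_nonneg_nonneg real_norm_def zero_le_one)
  then have "(1 + (c - t))\<^sup>2 \<le> c - t"
    using le [of z] by linarith
  then show False
    using \<open>0 \<le> c - t\<close> power2_sum [of 1 "c - t"] zero_le_power2 [of "c - t"] by simp
qed

section \<open>Averaging over shifts\<close>

text \<open>Double count pairs (x, t). Every difference of an element of \<open>B\<close> and a
  value of \<open>f\<close> lies among the 2L shifts in \<open>T\<close>, so each x has exactly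
  \<open>card B\<close> good shifts, and some shift is at least average.\<close>

lemma ex_popular_shift:
  fixes f :: "'a \<Rightarrow> int"
  assumes "finite X" and f: "\<And>x. x \<in> X \<Longrightarrow> 0 \<le> f x \<and> f x < L" and B: "B \<subseteq> {1..L}" and "L > 0"
  shows "\<exists>t. int (card X * card B) \<le> 2 * L * int (card {x \<in> X. f x + t \<in> B})"
proof (rule ccontr)
  assume "\<not> ?thesis"
  then have less: "2 * L * int (card {x \<in> X. f x + t \<in> B}) < int (card X * card B)" for t
    by (meson not_le)
  define T where "T = {- L<..L}"
  have "card {t \<in> T. f x + t \<in> B} = card B" if "x \<in> X" for x
  proof (rule bij_betw_same_card)
    show "bij_betw (\<lambda>t. f x + t) {t \<in> T. f x + t \<in> B} B"
    proof (rule bij_betw_byWitness [where f' = "\<lambda>b. b - f x"])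
      show "(\<lambda>b. b - f x) ` B \<subseteq> {t \<in> T. f x + t \<in> B}"
        using f [OF that] B by (fastforce simp: T_def)
    qed auto
  qed
  then have "card X * card B = (\<Sum>x\<in>X. card {t \<in> T. f x + t \<in> B})"
    by simp
  also have "\<dots> = (\<Sum>x\<in>X. \<Sum>t\<in>T. if f x + t \<in> B then 1 else 0)"
    by (rule sum.cong) (simp_all add: T_def sum.inter_filter [symmetric])
  also have "\<dots> = (\<Sum>t\<in>T. \<Sum>x\<in>X. if f x + t \<in> B then 1 else 0)"
    by (rule sum.swap)
  also have "\<dots> = (\<Sum>t\<in>T. card {x \<in> X. f x + t \<in> B})"
    using \<open>finite X\<close> by (intro sum.cong) (simp_all add: sum.inter_filter [symmetric])
  finally have eq: "int (card X * card B) = (\<Sum>t\<in>T. int (card {x \<in> X. f x + t \<in> B}))"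
    by simp
  have "2 * L * int (card X * card B) = (\<Sum>t\<in>T. 2 * L * int (card {x \<in> X. f x + t \<in> B}))"
    unfolding eq by (simp add: sum_distrib_left)
  also have "\<dots> < (\<Sum>t\<in>T. int (card X * card B))"
    using less \<open>L > 0\<close> by (intro sum_strict_mono) (auto simp: T_def)
  also have "\<dots> = 2 * L * int (card X * card B)"
    using \<open>L > 0\<close> by (simp add: T_def)
  finally show False
    by simp
qed

section \<open>Sets avoiding polynomial progressions\<close>

text \<open>The values of \<^term>\<open>p\<close> must be integers, but its coefficients may be arbitrary reals.\<close>

definition avoids_poly_progs :: "nat \<Rightarrow> nat \<Rightarrow> int set \<Rightarrow> bool" where
  "avoids_poly_progs D n A \<longleftrightarrow>
    (\<forall>p :: real poly. degree p \<le> D \<longrightarrow> (\<forall>j\<le>n. poly p (real j) \<in> real_of_int ` A) \<longrightarrow> degree p = 0)"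

lemma avoids_poly_progs_singleton:
  assumes "D \<le> n"
  shows "avoids_poly_progs D n {c}"
  unfolding avoids_poly_progs_def
  using assms by (auto intro: degree_eq_0_if_constant_values [of _ n "real_of_int c"])

text \<open>A progression is a polynomial of degree 1 in the index; the indices 0, ..., n account
  for \<open>1 + n\<close> terms.\<close>

lemma not_contains_ap_if_avoids_poly_progs:
  assumes "avoids_poly_progs 1 n A"
  shows "\<not> contains_ap (1 + n) A"
proof
  assume "contains_ap (1 + n) A"
  then obtain x y :: int where "y \<noteq> 0" and A: "{x + int j * y | j. j < 1 + n} \<subseteq> A"
    unfolding contains_ap_def by blast
  have "poly [:real_of_int x, real_of_int y:] (real j) \<in> real_of_int ` A" if "j \<le> n" for j
  proof (rule image_eqI)
    have "x + int j * y \<in> {x + int j * y | j. j < 1 + n}"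
      using that by (intro CollectI exI [of _ j]) simp
    then show "x + int j * y \<in> A"
      using A by blast
  qed (simp add: mult_ac)
  then have "degree [:real_of_int x, real_of_int y:] = 0"
    using assms \<open>y \<noteq> 0\<close> unfolding avoids_poly_progs_def by (metis degree_pCons_le degree_pCons_0 One_nat_def)
  then show False
    using \<open>y \<noteq> 0\<close> by simp
qed

lemma avoids_poly_progs_digits:
  fixes M d D n :: nat and t :: int and S :: "(nat \<Rightarrow> int) set"
  defines "b \<equiv> 2 ^ Suc D * int M"
  assumes S: "\<And>x i. x \<in> S \<Longrightarrow> i < d \<Longrightarrow> 0 \<le> x i \<and> x i < int M"
    and B: "\<And>x. x \<in> S \<Longrightarrow> (\<Sum>i<d. (x i)\<^sup>2) + t \<in> B"
    and avoid: "avoids_poly_progs (2 * D) n B" and n: "D \<le> n"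
  shows "avoids_poly_progs D n ((\<lambda>x. 1 + (\<Sum>i<d. x i * b ^ i)) ` S)"
  unfolding avoids_poly_progs_def
proof (intro allI impI)
  fix p :: "real poly"
  assume deg: "degree p \<le> D"
    and "\<forall>j\<le>n. poly p (real j) \<in> real_of_int ` (\<lambda>x. 1 + (\<Sum>i<d. x i * b ^ i)) ` S"
  then have "\<forall>j\<le>n. \<exists>x\<in>S. poly p (real j) = real_of_int (1 + (\<Sum>i<d. x i * b ^ i))"
    by (simp only: image_iff bex_simps)
  then obtain x where xS: "\<And>j. j \<le> n \<Longrightarrow> x j \<in> S"
    and px: "\<And>j. j \<le> n \<Longrightarrow> poly p (real j) = real_of_int (1 + (\<Sum>i<d. x j i * b ^ i))"
    by metis
  \<comment> \<open>The differences of order D + 1 of the encoded numbers vanish; read as a signed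
    base \<open>b\<close> expansion, this forces the differences of each digit to vanish.\<close>
  have digit: "fdiff (Suc D) (\<lambda>j. x j i) j = 0" if j: "j + Suc D \<le> n" and "i < d" for i j
  proof (rule digits_eq_0 [where e = "\<lambda>i. fdiff (Suc D) (\<lambda>j. x j i) j", OF _ _ \<open>i < d\<close>])
    have "real_of_int (fdiff (Suc D) (\<lambda>j. \<Sum>i<d. x j i * b ^ i) j)
        = fdiff (Suc D) (\<lambda>j. poly (p - 1) (real j)) j"
      \<comment> \<open>Subtracting 1 from \<open>p\<close> removes the offset of the
        encoding.\<close>
      unfolding of_int_fdiff using j by (intro fdiff_cong) (simp add: px)
    also have "\<dots> = 0"
      using deg degree_diff_le [of p D 1] by (intro fdiff_poly_eq_0) simp
    finally have "fdiff (Suc D) (\<lambda>j. \<Sum>i<d. x j i * b ^ i) j = 0"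
      by (simp only: of_int_eq_0_iff)
    then show "(\<Sum>i<d. fdiff (Suc D) (\<lambda>j. x j i) j * b ^ i) = 0"
      by (simp only: fdiff_sum fdiff_mult_right)
    fix i assume "i < d"
    \<comment> \<open>Each differencing at most doubles the bound, D + 1 times in all. The factor
      \<open>2 ^ Suc D\<close> in \<open>b\<close> is there to absorb this, so no carries
      occur.\<close>
    have "\<bar>fdiff (Suc D) (\<lambda>j. x j i) j\<bar> \<le> 2 ^ Suc D * (int M - 1)"
    proof (rule abs_fdiff_le)
      fix l assume "l \<le> j + Suc D"
      then show "\<bar>x l i\<bar> \<le> int M - 1"
        using S [OF xS [of l] \<open>i < d\<close>] j by auto
    qed
    also have "\<dots> < b"
      by (simp add: b_def)
    finally show "\<bar>fdiff (Suc D) (\<lambda>j. x j i) j\<bar> < b" .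
  qed
  have ex_q: "\<exists>q. degree q \<le> D \<and> (\<forall>j\<le>n. poly q (real j) = real_of_int (x j i))" if "i < d" for i
  proof (rule ex_poly_if_fdiff_eq_0)
    fix j assume "j + Suc D \<le> n"
    then show "fdiff (Suc D) (\<lambda>j. real_of_int (x j i)) j = 0"
      using digit that by (simp only: of_int_fdiff [symmetric] of_int_0)
  qed
  have "\<forall>i\<in>{..<d}. \<exists>q. degree q \<le> D \<and> (\<forall>j\<le>n. poly q (real j) = real_of_int (x j i))"
    using ex_q by simp
  from bchoice [OF this]
  obtain q where "\<forall>i\<in>{..<d}. degree (q i) \<le> D \<and> (\<forall>j\<le>n. poly (q i) (real j) = real_of_int (x j i))"
    by blast
  then have deg_q: "\<And>i. i < d \<Longrightarrow> degree (q i) \<le> D"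
    and q: "\<And>i j. i < d \<Longrightarrow> j \<le> n \<Longrightarrow> poly (q i) (real j) = real_of_int (x j i)"
    by auto
  \<comment> \<open>At each index up to \<open>n\<close>, \<open>Q\<close> is the shifted sum of
    squared digits, an element of \<open>B\<close>. Squaring doubles the degree, hence the use of
    \<open>2 * D\<close> for \<open>B\<close> with the same \<open>n\<close>.\<close>
  define Q where "Q = (\<Sum>i<d. (q i)\<^sup>2) + [:real_of_int t:]"
  have "degree ((q i)\<^sup>2) \<le> 2 * D" if "i < d" for i
    using order.trans [OF degree_power_le, of "q i" 2 "2 * D"] deg_q [OF that] by simp
  then have "degree Q \<le> 2 * D"
    unfolding Q_def by (intro degree_add_le degree_sum_le) auto
  moreover have "poly Q (real j) \<in> real_of_int ` B" if "j \<le> n" for j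
    using B [OF xS [OF that]] q that
    by (intro image_eqI [of _ _ "(\<Sum>i<d. (x j i)\<^sup>2) + t"]) (simp_all add: Q_def poly_sum)
  ultimately have "degree Q = 0"
    using avoid unfolding avoids_poly_progs_def by blast
  then have "degree (q i) = 0" if "i < d" for i
    using degree_eq_0_if_sum_squares_constant [of "{..<d}" q] that by (simp add: Q_def)
  then have "poly (q i) (real j) = poly (q i) (real 0)" if "i < d" for i j
    using that by (metis degree_eq_zeroE poly_pCons poly_0 mult_zero_right)
  then have "x j i = x 0 i" if "i < d" "j \<le> n" for i j
    using q [OF that] q [OF that(1) le0] that(1) by (metis of_int_eq_iff)
  then have "(\<Sum>i<d. x j i * b ^ i) = (\<Sum>i<d. x 0 i * b ^ i)" if "j \<le> n" for j
    using that by (intro sum.cong refl) (metis lessThan_iff)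
  then have "poly p (real j) = poly p (real 0)" if "j \<le> n" for j
    using px [OF that] px [OF le0] that by metis
  then show "degree p = 0"
    using deg n by (intro degree_eq_0_if_constant_values [of p n "poly p (real 0)"]) auto
qed

lemma ex_avoiding_set_from_digits:
  fixes M d D n N :: nat
  assumes "M > 0" "d > 0" and N: "(2 ^ Suc D * M) ^ d \<le> N"
    and B: "B \<subseteq> {1..int (d * M\<^sup>2)}" "avoids_poly_progs (2 * D) n B" and n: "D \<le> n"
  shows "\<exists>A \<subseteq> {1..int N}. avoids_poly_progs D n A \<and> M ^ d * card B \<le> 2 * (d * M\<^sup>2) * card A"
proof -
  define b where "b = 2 ^ Suc D * int M"
  define X where "X = {..<d} \<rightarrow>\<^sub>E {0..<int M}"
  \<comment> \<open>The offset 1 moves the codes from 0, ..., b^d - 1 into 1, ..., b^d.\<close>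
  define enc where "enc = (\<lambda>x. 1 + (\<Sum>i<d. x i * b ^ i))"
  have X: "0 \<le> x i \<and> x i < int M" if "x \<in> X" "i < d" for x i
    using that by (auto simp: X_def PiE_iff)
  have "int M \<le> b"
    using mult_right_mono [OF one_le_power, of "2 :: int" "int M" "Suc D"] by (simp add: b_def)
  have "finite X" "card X = M ^ d"
    by (simp_all add: X_def finite_PiE card_PiE)
  have f: "0 \<le> (\<Sum>i<d. (x i)\<^sup>2) \<and> (\<Sum>i<d. (x i)\<^sup>2) < int (d * M\<^sup>2)" if "x \<in> X" for x
  proof
    have "(\<Sum>i<d. (x i)\<^sup>2) < (\<Sum>i<d. (int M)\<^sup>2)"
      using X [OF that] \<open>d > 0\<close> by (intro sum_strict_mono power_strict_mono) auto
    then show "(\<Sum>i<d. (x i)\<^sup>2) < int (d * M\<^sup>2)"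
      by simp
  qed (simp add: sum_nonneg)
  obtain t where t: "int (card X * card B)
      \<le> 2 * int (d * M\<^sup>2) * int (card {x \<in> X. (\<Sum>i<d. (x i)\<^sup>2) + t \<in> B})"
    using ex_popular_shift [OF \<open>finite X\<close>, of "\<lambda>x. \<Sum>i<d. (x i)\<^sup>2", OF f B(1)] \<open>M > 0\<close> \<open>d > 0\<close>
    by fastforce
  define S where "S = {x \<in> X. (\<Sum>i<d. (x i)\<^sup>2) + t \<in> B}"
  have "inj_on enc X"
  proof (rule inj_onI)
    fix x y assume xy: "x \<in> X" "y \<in> X" and "enc x = enc y"
    then have "(\<Sum>i<d. (x i - y i) * b ^ i) = 0"
      by (simp add: enc_def sum_subtractf left_diff_distrib)
    then have "x i - y i = 0" if "i < d" for i
    proof (rule digits_eq_0 [where e = "\<lambda>i. x i - y i"])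
      fix i assume "i < d"
      then show "\<bar>x i - y i\<bar> < b"
        using X [OF xy(1), of i] X [OF xy(2), of i] \<open>int M \<le> b\<close> by linarith
    qed (use that in auto)
    then show "x = y"
      using xy unfolding X_def by (intro PiE_ext) auto
  qed
  then have "card (enc ` S) = card S"
    by (intro card_image) (auto simp: S_def inj_on_def)
  have "enc ` S \<subseteq> {1..int N}"
  proof clarify
    fix x assume "x \<in> S"
    then have x: "0 \<le> x i" "x i < b" if "i < d" for i
      using X [of x i] that \<open>int M \<le> b\<close> by (auto simp: S_def)
    have "b \<ge> 0"
      by (simp add: b_def)
    have "0 \<le> (\<Sum>i<d. x i * b ^ i)"
      using x(1) \<open>b \<ge> 0\<close> by (intro sum_nonneg) simp
    moreover have "(\<Sum>i<d. x i * b ^ i) < b ^ d"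
      using x(2) \<open>b \<ge> 0\<close> by (rule digits_sum_less)
    moreover have "b ^ d \<le> int N"
    proof -
      have "b ^ d = int ((2 ^ Suc D * M) ^ d)"
        by (simp add: b_def)
      then show ?thesis
        using N by linarith
    qed
    ultimately show "enc x \<in> {1..int N}"
      by (simp add: enc_def)
  qed
  moreover have "avoids_poly_progs D n (enc ` S)"
    unfolding enc_def b_def using B(2) n X
    by (intro avoids_poly_progs_digits [where t = t and B = B]) (auto simp: S_def)
  moreover have "M ^ d * card B \<le> 2 * (d * M\<^sup>2) * card (enc ` S)"
    using t \<open>card X = M ^ d\<close> \<open>card (enc ` S) = card S\<close> unfolding S_def [symmetric]
    by (metis of_nat_le_iff of_nat_mult of_nat_numeral)
  ultimately show ?thesis
    by blast
qed

section \<open>Density bounds by induction on k\<close>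

text \<open>When \<^term>\<open>s\<close> is so large that the claimed density is below \<open>1 / N\<close>, one point suffices.\<close>

lemma ex_singleton_avoiding:
  fixes s C :: real
  assumes "N > 0" "ln (real N) \<le> C * s" "D \<le> n"
  shows "\<exists>A \<subseteq> {1..int N}. avoids_poly_progs D n A \<and> real N * exp (- C * s) \<le> real (card A)"
proof (intro exI [of _ "{1}"] conjI)
  have "real N * exp (- C * s) = exp (ln (real N) - C * s)"
    using assms(1) by (simp add: exp_diff exp_minus divide_inverse)
  then show "real N * exp (- C * s) \<le> real (card {1::int})"
    using assms(2) by simp
qed (use assms avoids_poly_progs_singleton in auto)

text \<open>Only an upper bound \<open>s\<close> for the root of \<open>ln N\<close> is prescribed,
  so that the hypothesis can be applied to the shorter interval with \<open>4 * s\<close>. In the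
  new constant, \<open>4 * C\<close> comes from that application,
  \<open>2 * ln (2 * 2 ^ Suc D)\<close> from restricting and rounding at most 2s digits, and 1 from
  the factor 2 lost in averaging.\<close>

lemma ex_large_avoiding_set_step:
  fixes C s :: real
  assumes IH: "\<And>N s. N > 0 \<Longrightarrow> s \<ge> 0 \<Longrightarrow> ln (real N) \<le> s ^ Suc k \<Longrightarrow>
      \<exists>A \<subseteq> {1..int N}. avoids_poly_progs (2 * D) n A \<and> real N * exp (- C * s) \<le> real (card A)"
    and "C \<ge> 0" and n: "D \<le> n" and "N > 0" "s \<ge> 0" and N: "ln (real N) \<le> s ^ Suc (Suc k)"
  shows "\<exists>A \<subseteq> {1..int N}. avoids_poly_progs D n A \<and>
           real N * exp (- (4 * C + 2 * ln (2 * 2 ^ Suc D) + 1) * s) \<le> real (card A)"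
proof -
  define K :: nat where "K = 2 ^ Suc D"
  define C' where "C' = 4 * C + 2 * ln (2 * real K) + 1"
  have "K \<ge> 1"
    by (simp add: K_def)
  then have lnK: "0 \<le> ln (real K)" "ln (2 * real K) = ln 2 + ln (real K)"
    by (simp_all add: ln_mult)
  then have C'_ge: "C' \<ge> 1" "C' \<ge> 2 * ln (real K)"
    using \<open>C \<ge> 0\<close> by (simp_all add: C'_def)
  \<comment> \<open>About \<open>s\<close> digits; rounding up gives at most 2s once s \<ge>
    1.\<close>
  define d where "d = nat \<lceil>s\<rceil>"
  \<comment> \<open>In the first two cases (s < 1, or N < K^d) \<open>ln N\<close> is at most
    \<open>C' * s\<close>, and a singleton is dense enough.\<close>
  consider "s < 1" | "s \<ge> 1" "ln (real N) < real d * ln (real K)"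
    | "s \<ge> 1" "real d * ln (real K) \<le> ln (real N)"
    by linarith
  then have "\<exists>A \<subseteq> {1..int N}. avoids_poly_progs D n A \<and> real N * exp (- C' * s) \<le> real (card A)"
  proof cases
    case 1
    have "s ^ Suc (Suc k) \<le> s ^ 1"
      using 1 \<open>s \<ge> 0\<close> by (intro power_decreasing) auto
    also have "\<dots> \<le> C' * s"
      using C'_ge \<open>s \<ge> 0\<close> by (simp add: mult_le_cancel_right1)
    finally show ?thesis
      using N \<open>N > 0\<close> n by (intro ex_singleton_avoiding) auto
  next
    case 2
    have "real d \<le> 2 * s"
      using 2 by (simp add: d_def) linarith
    then have "real d * ln (real K) \<le> 2 * s * ln (real K)"
      using lnK by (intro mult_right_mono) auto
    also have "\<dots> \<le> C' * s"
      using C'_ge mult_right_mono [of "2 * ln (real K)" C' s] \<open>s \<ge> 0\<close> by (simp add: mult_ac)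
    finally show ?thesis
      using 2 \<open>N > 0\<close> n by (intro ex_singleton_avoiding) auto
  next
    case 3
    have d: "s \<le> real d" "real d \<le> 2 * s" "d > 0"
      using 3(1) by (simp_all add: d_def) linarith+
    \<comment> \<open>The real \<open>d\<close>-th root of \<open>N\<close>, which bounds the
      admissible base \<open>K * M\<close>.\<close>
    define R where "R = exp (ln (real N) / real d)"
    have R_pow: "R ^ d = real N"
      using d \<open>N > 0\<close> by (simp add: R_def exp_of_nat_mult [symmetric])
    have "R \<ge> real K"
    proof -
      have "exp (ln (real K)) \<le> R"
        unfolding R_def using 3(2) d(3) by (simp add: field_simps)
      then show ?thesis
        using \<open>K \<ge> 1\<close> by simp
    qed
    have lnR: "ln R \<le> s ^ Suc k"
    proof -
      have "ln R \<le> s ^ Suc (Suc k) / real d"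
        unfolding R_def using N d(3) by (simp add: divide_right_mono)
      also have "\<dots> \<le> s ^ Suc (Suc k) / s"
        using d 3 by (intro divide_left_mono) auto
      also have "\<dots> = s ^ Suc k"
        using 3 by simp
      finally show ?thesis .
    qed
    \<comment> \<open>Since R / K \<ge> 1, rounding down loses at most a factor 2 per digit.\<close>
    define M where "M = nat \<lfloor>R / real K\<rfloor>"
    have "R / real K \<ge> 1"
      using \<open>R \<ge> real K\<close> \<open>K \<ge> 1\<close> by simp
    then have "real M = real_of_int \<lfloor>R / real K\<rfloor>" and "1 \<le> \<lfloor>R / real K\<rfloor>"
      by (simp_all add: M_def)
    then have "real M \<le> R / real K" and "R / real K < real M + 1" and "real M \<ge> 1"
      by linarith+
    then have M: "M > 0" "real M \<le> R / real K" "R / real K / 2 \<le> real M"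
      by simp_all
    have "real ((K * M) ^ d) \<le> R ^ d"
      using M(2) \<open>K \<ge> 1\<close> by (simp add: field_simps power_mono flip: power_mult_distrib)
    then have KM: "(2 ^ Suc D * M) ^ d \<le> N"
      unfolding R_pow K_def by (metis of_nat_le_iff)
    define L where "L = d * M\<^sup>2"
    have "L > 0"
      using M d by (simp add: L_def)
    have "real M \<le> R"
    proof -
      have "R / real K \<le> R / 1"
        using \<open>K \<ge> 1\<close> by (intro divide_left_mono) (simp_all add: R_def)
      then show ?thesis
        using M(2) by simp
    qed
    have "ln (real L) = ln (real d) + 2 * ln (real M)"
      using M d by (simp add: L_def ln_mult ln_realpow)
    also have "\<dots> \<le> real d + 2 * ln R"
    proof -
      have "ln (real d) \<le> real d"
        using d ln_le_minus_one [of "real d"] by simp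
      moreover have "ln (real M) \<le> ln R"
        using \<open>real M \<le> R\<close> M by simp
      ultimately show ?thesis
        by simp
    qed
    \<comment> \<open>Both d and 2 ln R are at most 2 s^(k+1), using s \<ge> 1 for the
      former.\<close>
    also have "\<dots> \<le> 4 * s ^ Suc k"
      using d(2) lnR power_increasing [of 1 "Suc k" s] 3 unfolding power_one_right by linarith
    also have "\<dots> \<le> 4 ^ Suc k * s ^ Suc k"
      using 3 by (intro mult_right_mono) auto
    finally have "ln (real L) \<le> (4 * s) ^ Suc k"
      by (simp only: power_mult_distrib)
    then obtain B where B: "B \<subseteq> {1..int L}" "avoids_poly_progs (2 * D) n B"
      "real L * exp (- C * (4 * s)) \<le> real (card B)"
      using IH [of L "4 * s"] \<open>L > 0\<close> 3 by auto
    obtain A where A: "A \<subseteq> {1..int N}" "avoids_poly_progs D n A"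
      "M ^ d * card B \<le> 2 * L * card A"
      using ex_avoiding_set_from_digits [OF M(1) d(3) KM B(1)[unfolded L_def] B(2) n]
      unfolding L_def by blast
    have "real N * exp (- 2 * s * ln (2 * real K)) \<le> real N * exp (- real d * ln (2 * real K))"
    proof (rule mult_left_mono)
      have "real d * ln (2 * real K) \<le> 2 * s * ln (2 * real K)"
        using d(2) lnK by (intro mult_right_mono) simp_all
      then show "exp (- 2 * s * ln (2 * real K)) \<le> exp (- real d * ln (2 * real K))"
        by simp
    qed simp
    also have "\<dots> = (R / (2 * real K)) ^ d"
    proof -
      have "exp (real d * ln (2 * real K)) = (2 * real K) ^ d"
        using \<open>K \<ge> 1\<close> by (simp only: exp_of_nat_mult) simp
      then show ?thesis
        by (simp only: power_divide R_pow exp_minus mult_minus_left) (simp only: divide_inverse)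
    qed
    also have "\<dots> \<le> real M ^ d"
      using M(3) by (intro power_mono) (simp_all add: R_def mult.commute)
    finally have M_pow: "real N * exp (- 2 * s * ln (2 * real K)) \<le> real M ^ d" .
    \<comment> \<open>One factor exp(-s) pays for the 2 in \<open>2 * L\<close>.\<close>
    have "exp (- s) \<le> 1 / 2"
    proof -
      have "2 \<le> exp s"
        using exp_ge_add_one_self [of s] 3 by linarith
      then show ?thesis
        by (simp add: exp_minus field_simps)
    qed
    have "real N * exp (- C' * s) * (2 * real L)
        = (real N * exp (- 2 * s * ln (2 * real K))) * (real L * exp (- C * (4 * s))) * (2 * exp (- s))"
      by (simp add: C'_def algebra_simps flip: exp_add)
    also have "\<dots> \<le> (real M ^ d * real (card B)) * 1"
      using \<open>exp (- s) \<le> 1 / 2\<close> by (intro mult_mono M_pow B(3)) auto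
    also have "\<dots> \<le> real (card A) * (2 * real L)"
    proof -
      have "real (M ^ d * card B) \<le> real (2 * L * card A)"
        using A(3) of_nat_le_iff by blast
      then show ?thesis
        by (simp add: mult_ac)
    qed
    finally have "real N * exp (- C' * s) \<le> real (card A)"
      using \<open>L > 0\<close> by simp
    then show ?thesis
      using A by blast
  qed
  then show ?thesis
    by (simp add: C'_def K_def)
qed

text \<open>The degree bound \<open>D\<close> stays arbitrary in the induction because the step for
  \<open>D\<close> calls on \<open>2 * D\<close>; the length parameter is unchanged, as 2^k (2D) =
  2^(k+1) D.\<close>

lemma ex_large_avoiding_set:
  "\<exists>C\<ge>0. \<forall>N>0. \<forall>s\<ge>0. ln (real N) \<le> s ^ Suc k \<longrightarrow>
     (\<exists>A \<subseteq> {1..int N}. avoids_poly_progs D (2 ^ k * D) A \<and> real N * exp (- C * s) \<le> real (card A))"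
proof (induction k arbitrary: D)
  case 0
  show ?case
    \<comment> \<open>For k = 0 the assumption reads ln N \<le> s, so C = 1 lets a singleton
      suffice.\<close>
    by (intro exI [of _ 1] conjI allI impI ex_singleton_avoiding) auto
next
  case (Suc k)
  obtain C where C: "C \<ge> 0" "\<And>N s. N > 0 \<Longrightarrow> s \<ge> 0 \<Longrightarrow> ln (real N) \<le> s ^ Suc k \<Longrightarrow>
      \<exists>A \<subseteq> {1..int N}. avoids_poly_progs (2 * D) (2 ^ k * (2 * D)) A \<and>
        real N * exp (- C * s) \<le> real (card A)"
    using Suc.IH [of "2 * D"] by blast
  have "2 ^ k * (2 * D) = 2 ^ Suc k * D" and "D \<le> 2 ^ Suc k * D"
    by simp_all
  have "0 \<le> 4 * C + 2 * ln (2 * 2 ^ Suc D) + 1"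
    using C(1) one_le_power [of "2 :: real" "Suc (Suc D)"] by (intro add_nonneg_nonneg mult_nonneg_nonneg ln_ge_zero) auto
  then show ?case
    using ex_large_avoiding_set_step [of k D "2 ^ Suc k * D" C] C
      \<open>2 ^ k * (2 * D) = 2 ^ Suc k * D\<close> \<open>D \<le> 2 ^ Suc k * D\<close>
    by (intro exI [of _ "4 * C + 2 * ln (2 * 2 ^ Suc D) + 1"]) auto
qed

section \<open>The bound for r\<close>

lemma card_le_r:
  assumes "A \<subseteq> {1..int N}" "\<not> contains_ap l A"
  shows "card A \<le> r l N"
  unfolding r_def
proof (rule Max_ge)
  have "{card A | A. A \<subseteq> {1..int N} \<and> \<not> contains_ap l A} \<subseteq> card ` Pow {1..int N}"
    by blast
  then show "finite {card A | A. A \<subseteq> {1..int N} \<and> \<not> contains_ap l A}"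
    by (rule finite_subset) simp
qed (use assms in blast)

theorem theorem1:
  fixes k :: nat
  assumes "k \<ge> 1"
  shows "\<exists>C::real. C > 0 \<and>
           (\<forall>N::nat. N > k \<longrightarrow>
              real (r (1 + 2 ^ k) N) \<ge> real N * exp (- C * (ln (real N)) powr (1 / (real k + 1))))"
proof -
  obtain C where "C \<ge> 0" and C: "\<And>N s. N > 0 \<Longrightarrow> s \<ge> 0 \<Longrightarrow> ln (real N) \<le> s ^ Suc k \<Longrightarrow>
      \<exists>A \<subseteq> {1..int N}. avoids_poly_progs 1 (2 ^ k) A \<and> real N * exp (- C * s) \<le> real (card A)"
    using ex_large_avoiding_set [of k 1] by auto
  \<comment> \<open>\<open>C + 1\<close> replaces \<open>C\<close> because a strictly positive
    constant is demanded and \<open>C\<close> may be 0.\<close>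
  have "real N * exp (- (C + 1) * ln (real N) powr (1 / (real k + 1))) \<le> real (r (1 + 2 ^ k) N)"
    if "N > k" for N
  proof -
    define s where "s = ln (real N) powr (1 / (real k + 1))"
    \<comment> \<open>Here N > k \<ge> 1 gives N \<ge> 2; positivity of the logarithm lets
      \<open>powr\<close> be turned into the natural power \<open>s ^ Suc k\<close>.\<close>
    have "ln (real N) > 0"
      using assms that by simp
    then have "s ^ Suc k = s powr real (Suc k)"
      by (intro powr_realpow [symmetric]) (simp add: s_def)
    then have "s ^ Suc k = ln (real N)"
      using \<open>ln (real N) > 0\<close> by (simp add: s_def powr_powr add.commute)
    moreover have "N > 0" "s \<ge> 0"
      using that by (simp_all add: s_def)
    ultimately obtain A where A: "A \<subseteq> {1..int N}" "avoids_poly_progs 1 (2 ^ k) A"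
      "real N * exp (- C * s) \<le> real (card A)"
      using C [of N s] by (metis order_refl)
    have "real N * exp (- (C + 1) * s) \<le> real N * exp (- C * s)"
      by (intro mult_left_mono) (auto simp: s_def algebra_simps)
    also have "\<dots> \<le> real (r (1 + 2 ^ k) N)"
      using A card_le_r not_contains_ap_if_avoids_poly_progs by (meson of_nat_le_iff order.trans)
    finally show ?thesis
      by (simp add: s_def)
  qed
  then show ?thesis
    using \<open>C \<ge> 0\<close> by (intro exI [of _ "C + 1"]) auto
qed

end
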